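(* Let $r\ge 1$. For $1\le j\le r$ let $G_j=(V_j,E_j)$ be a connected graph on $n_j+1=|V_j|\ge 2$ vertices ($n_j=\infty$ may happen) with a distinguished vertex $o_j\in V_j$. Assume that every $G_j$ is of QE class with QE constant $Q_j=\mathrm{QEC}(G_j)<0$. Then $$\max\{Q_1,\dots,Q_r\}\le \mathrm{QEC}(G_1\star\dots\star G_r)\le -\Lambda,$$ where $\Lambda$ is the minimal solution $\lambda$ of $$\sum_{j=1}^r\frac{n_j}{-Q_jn_j-Q_j-\lambda}=\frac1\lambda .$$
   Context: Graphs are undirected and may be finite or infinite. For a connected graph $G=(V,E)$, $d(x,y)$ denotes the graph distance (length of a shortest path) and $D=[d(x,y)]_{x,y\in V}$ the distance matrix. $C_0(V)$ is the space of real-valued functions on $V$ with finite support, $\langle f,g\rangle=\sum_{x\in V}f(x)g(x)$, and $\langle \mathbf 1,f\rangle=\sum_{x\in V}f(x)$. The QE constant is $\mathrm{QEC}(G)=\sup\{\langle f,Df\rangle : f\in C_0(V),\ \langle f,f\rangle=1,\ \langle\mathbf 1,f\rangle=0\}$. $G$ is of QE class if there is a map $\varphi$ from $V$ into a real Hilbert space with $\|\varphi(x)-\varphi(y)\|^2=d(x,y)$ for all $x,y\in V$ (equivalently, $\mathrm{QEC}(G)\le 0$). Given connected graphs $G_j=(V_j,E_j)$ with distinguished vertices $o_j\in V_j$, $1\le j\le r$, the star product $G_1\star\dots\star G_r$ is the graph obtained from the disjoint union of the $G_j$ by identifying all the vertices $o_1,\dots,o_r$ to a single vertex. Convention: if $n_j=\infty$,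 the term $\frac{n_j}{-Q_jn_j-Q_j-\lambda}$ is understood as $\frac{1}{-Q_j}$. The minimal solution is the smallest real number $\lambda$ (with $\lambda\ne0$ and no denominator vanishing) satisfying the equation. *)

theory Defs
  imports
    "Graph_Theory.Graph_Theory"
    "HOL-Analysis.Inner_Product"
    "HOL-Library.Extended_Nat"
    "HOL-Library.Extended_Real"
    "HOL-Library.Groups_Big_Fun"
begin

text \<open>
  Undirected graphs, finite or infinite, are symmetric loop-free digraphs: an edge between
  \<open>x\<close> and \<open>y\<close> is the pair of arcs \<open>(x, y)\<close> and \<open>(y, x)\<close>.
  The predicate \<open>connected\<close> is qualified because the topological one has the same name.
\<close>

definition connected_graph :: "'a pair_pre_digraph \<Rightarrow> bool" where
  "connected_graph G \<longleftrightarrow>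
     pair_bidirected_digraph G \<and> Digraph_Component.connected (with_proj G)"

definition vertex_count :: "'a pair_pre_digraph \<Rightarrow> enat" where
  "vertex_count G = (if finite (pverts G) then enat (card (pverts G)) else \<infinity>)"

text \<open>
  With unit weights the cost of a walk is its length, and \<open>\<mu>\<close> takes the infimum over all walks,
  which is the length of a shortest path.
\<close>

definition graph_dist :: "'a pair_pre_digraph \<Rightarrow> 'a \<Rightarrow> 'a \<Rightarrow> real" where
  "graph_dist G x y = real_of_ereal (wf_digraph.\<mu> (with_proj G) (\<lambda>_. 1) x y)"

definition C0 :: "'a set \<Rightarrow> ('a \<Rightarrow> real) set" where
  "C0 V = {f. finite {x. f x \<noteq> 0} \<and> {x. f x \<noteq> 0} \<subseteq> V}"

text \<open>
  Functions on \<open>V\<close> are extended by zero to the whole type, so sums over \<open>V\<close> are sums over the type.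
  \<open>Sum_any\<close> sums over the support; every summand below has finite support when \<open>f \<in> C0 V\<close>.
\<close>

definition pairing :: "('a \<Rightarrow> real) \<Rightarrow> ('a \<Rightarrow> real) \<Rightarrow> real" where
  "pairing f g = Sum_any (\<lambda>x. f x * g x)"

definition dist_matrix_apply :: "'a pair_pre_digraph \<Rightarrow> ('a \<Rightarrow> real) \<Rightarrow> 'a \<Rightarrow> real" where
  "dist_matrix_apply G f x = Sum_any (\<lambda>y. graph_dist G x y * f y)"

text \<open>The supremum is taken in the extended reals, since the set may be unbounded or empty.\<close>

definition QEC :: "'a pair_pre_digraph \<Rightarrow> ereal" where
  "QEC G = (SUP f \<in> {f \<in> C0 (pverts G). pairing f f = 1 \<and> pairing (\<lambda>_. 1) f = 0}.
              ereal (pairing f (dist_matrix_apply G f)))"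

text \<open>
  HOL cannot quantify over the Hilbert space inside a formula, so it is given by a type argument;
  a hypothesis \<open>qe_class TYPE('h) G\<close> with \<open>'h\<close> a type variable covers every real Hilbert space.
\<close>

definition qe_class ::
    "'h::{real_inner, complete_space} itself \<Rightarrow> 'a pair_pre_digraph \<Rightarrow> bool" where
  "qe_class H G \<longleftrightarrow>
     (\<exists>\<phi> :: 'a \<Rightarrow> 'h. \<forall>x\<in>pverts G. \<forall>y\<in>pverts G. (norm (\<phi> x - \<phi> y))\<^sup>2 = graph_dist G x y)"

text \<open>
  The identification map on the disjoint union: \<open>None\<close> is the common vertex to which all
  base points \<open>b j\<close> are sent, and the other vertices \<open>x\<close> of the \<open>j\<close>-th graph become
  \<open>Some (j, x)\<close>.
\<close>

definition star_map :: "(nat \<Rightarrow> 'a) \<Rightarrow> nat \<Rightarrow> 'a \<Rightarrow> (nat \<times> 'a) option" where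
  "star_map b j x = (if x = b j then None else Some (j, x))"

definition star_product ::
    "nat \<Rightarrow> (nat \<Rightarrow> 'a pair_pre_digraph) \<Rightarrow> (nat \<Rightarrow> 'a) \<Rightarrow> (nat \<times> 'a) option pair_pre_digraph" where
  "star_product r G b =
     \<lparr> pverts = (\<Union>j\<in>{1..r}. star_map b j ` pverts (G j)),
       parcs = (\<Union>j\<in>{1..r}. map_prod (star_map b j) (star_map b j) ` parcs (G j)) \<rparr>"

definition star_term :: "enat \<Rightarrow> real \<Rightarrow> real \<Rightarrow> real" where
  "star_term n Q l =
     (case n of enat m \<Rightarrow> real m / (- Q * real m - Q - l) | \<infinity> \<Rightarrow> 1 / (- Q))"

text \<open>
  Division by zero is zero in HOL, so the nonvanishing of \<open>l\<close> and of the denominators is explicit.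
\<close>

definition star_solution :: "nat \<Rightarrow> (nat \<Rightarrow> enat) \<Rightarrow> (nat \<Rightarrow> real) \<Rightarrow> real \<Rightarrow> bool" where
  "star_solution r n Q l \<longleftrightarrow>
     l \<noteq> 0 \<and>
     (\<forall>j\<in>{1..r}. \<forall>m. n j = enat m \<longrightarrow> - Q j * real m - Q j - l \<noteq> 0) \<and>
     (\<Sum>j=1..r. star_term (n j) (Q j) l) = 1 / l"

definition minimal_star_solution :: "nat \<Rightarrow> (nat \<Rightarrow> enat) \<Rightarrow> (nat \<Rightarrow> real) \<Rightarrow> real \<Rightarrow> bool" where
  "minimal_star_solution r n Q l \<longleftrightarrow>
     star_solution r n Q l \<and> (\<forall>l'. star_solution r n Q l' \<longrightarrow> l \<le> l')"

end

theory Submission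
  imports Defs "HOL-Analysis.Convex"
begin

text \<open>
  Every path between two different factors of a star product passes through the common vertex,
  so distances inside a factor do not change, and
  \<open>d(x, y) = d(x, o) + d(o, y)\<close> for \<open>x\<close> and \<open>y\<close> in different factors
  (\<open>graph_dist_star\<close>).  Each factor is thus embedded isometrically, and a function on
  \<open>V\<^sub>j\<close> extended by zero competes in the supremum for the star.  This is the lower bound
  (\<open>QEC_mono_isometry\<close>).

  For the upper bound, let \<open>f\<close> be a function of sum zero on the star, with
  \<open>\<langle>f, f\<rangle> = 1\<close>.  It splits as
  \<open>f = \<Sum>\<^sub>j g\<^sub>j\<close>, where \<open>g\<^sub>j\<close> lives on \<open>V\<^sub>j\<close>, has sum zero and agrees
  with \<open>f\<close> off the base point (\<open>zero_sum_pieces\<close>).  The mixed terms of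
  \<open>\<langle>f, D f\<rangle>\<close> vanish by the additivity of the distance
  (\<open>dist_form_pieces\<close>), so
  \<open>\<langle>f, D f\<rangle> = \<Sum>\<^sub>j \<langle>g\<^sub>j, D\<^sub>j g\<^sub>j\<rangle> \<le> \<Sum>\<^sub>j Q\<^sub>j (s\<^sub>j\<^sup>2 + P\<^sub>j)\<close>,
  where \<open>s\<^sub>j = g\<^sub>j(o\<^sub>j)\<close> and \<open>P\<^sub>j\<close> is the squared norm of \<open>g\<^sub>j\<close> off the
  base point.  The pieces overlap only at the common vertex:
  \<open>1 = (\<Sum>\<^sub>j s\<^sub>j)\<^sup>2 + \<Sum>\<^sub>j P\<^sub>j\<close>.

  It remains to show
  \<open>\<Lambda> (\<Sum>\<^sub>j s\<^sub>j)\<^sup>2 \<le> \<Sum>\<^sub>j ((- Q\<^sub>j - \<Lambda>) P\<^sub>j - Q\<^sub>j s\<^sub>j\<^sup>2)\<close>.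
  As \<open>g\<^sub>j\<close> has sum zero, Cauchy-Schwarz gives
  \<open>s\<^sub>j\<^sup>2 \<le> n\<^sub>j P\<^sub>j\<close>.  Since \<open>\<Lambda> \<le> - Q\<^sub>j\<close>, the
  \<open>j\<close>-th summand on the right is at least \<open>s\<^sub>j\<^sup>2 / t\<^sub>j\<close>, with
  \<open>t\<^sub>j = n\<^sub>j / (- Q\<^sub>j n\<^sub>j - Q\<^sub>j - \<Lambda>)\<close>, or \<open>t\<^sub>j = 1 / (- Q\<^sub>j)\<close> when
  \<open>n\<^sub>j\<close> is infinite (\<open>piece_bound\<close>).  Now
  \<open>(\<Sum>\<^sub>j s\<^sub>j)\<^sup>2 \<le> (\<Sum>\<^sub>j s\<^sub>j\<^sup>2 / t\<^sub>j) (\<Sum>\<^sub>j t\<^sub>j)\<close>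
  (\<open>sum_squared_le_weighted\<close>), and the equation for \<open>\<Lambda>\<close> says precisely that
  \<open>\<Sum>\<^sub>j t\<^sub>j = 1 / \<Lambda>\<close>.  That a least solution exists and satisfies
  \<open>0 < \<Lambda> \<le> - Q\<^sub>j\<close> for all \<open>j\<close> is
  \<open>minimal_star_solution_exists\<close>.
\<close>

section \<open>Graph distance and walks\<close>

text \<open>
  A walk between any two vertices makes the infimum of walk lengths finite and attained.
\<close>

locale walk_connected = pair_wf_digraph G for G :: "'a pair_pre_digraph" +
  assumes ex_awalk: "\<lbrakk>x \<in> pverts G; y \<in> pverts G\<rbrakk> \<Longrightarrow> \<exists>p. awalk x p y"
begin

lemma awalk_cost_unit: "awalk_cost (\<lambda>_. 1) p = real (length p)"
  by (induction p) auto

lemma graph_dist_attained: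
  assumes "x \<in> pverts G" "y \<in> pverts G"
  shows "\<exists>p. awalk x p y \<and> graph_dist G x y = real (length p)"
    and "awalk x p y \<Longrightarrow> graph_dist G x y \<le> real (length p)"
proof -
  define N where "N = (LEAST n. \<exists>p. awalk x p y \<and> length p = n)"
  obtain q where q: "awalk x q y" "length q = N"
    using LeastI_ex[of "\<lambda>n. \<exists>p. awalk x p y \<and> length p = n"] ex_awalk[OF assms]
    unfolding N_def by blast
  have N_le: "N \<le> length p" if "awalk x p y" for p
    unfolding N_def using that by (blast intro: Least_le)
  have "\<mu> (\<lambda>_. 1) x y = ereal (real N)"
    unfolding \<mu>_def awalk_cost_unit
  proof (rule antisym)
    show "(INF p\<in>{p. awalk x p y}. ereal (real (length p))) \<le> ereal (real N)"
      using q by (auto intro!: INF_lower2[of q])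
    show "ereal (real N) \<le> (INF p\<in>{p. awalk x p y}. ereal (real (length p)))"
      using N_le by (auto intro!: INF_greatest)
  qed
  then have d: "graph_dist G x y = real N"
    by (simp add: graph_dist_def)
  show "\<exists>p. awalk x p y \<and> graph_dist G x y = real (length p)"
    using q d by auto
  show "graph_dist G x y \<le> real (length p)" if "awalk x p y"
    using N_le[OF that] d by simp
qed

lemma graph_dist_refl:
  assumes "x \<in> pverts G"
  shows "graph_dist G x x = 0"
proof -
  have "awalk x [] x"
    using assms by (simp add: awalk_Nil_iff)
  then have "graph_dist G x x \<le> 0"
    using graph_dist_attained(2)[OF assms assms, of "[]"] by simp
  moreover have "graph_dist G x x \<ge> 0"
    using graph_dist_attained(1)[OF assms assms] by auto
  ultimately show ?thesis by simp
qed

lemma graph_dist_triangle: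
  assumes "x \<in> pverts G" "y \<in> pverts G" "z \<in> pverts G"
  shows "graph_dist G x z \<le> graph_dist G x y + graph_dist G y z"
proof -
  obtain p where p: "awalk x p y" "graph_dist G x y = real (length p)"
    using graph_dist_attained(1)[OF assms(1,2)] by blast
  obtain q where q: "awalk y q z" "graph_dist G y z = real (length q)"
    using graph_dist_attained(1)[OF assms(2,3)] by blast
  show ?thesis
    using graph_dist_attained(2)[OF assms(1,3) awalk_appendI[OF p(1) q(1)]] p(2) q(2) by simp
qed

lemma graph_dist_arc:
  assumes "(x, y) \<in> parcs G"
  shows "graph_dist G x y \<le> 1"
proof -
  have "awalk x [(x, y)] y"
    using assms arc_snd_in_verts[OF assms] by (simp add: awalk_Cons_iff awalk_Nil_iff)
  then show ?thesis
    using graph_dist_attained(2)[of x y "[(x, y)]"] assms arc_snd_in_verts[OF assms]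
      arc_fst_in_verts[OF assms] by simp
qed

text \<open>
  A potential that drops by at most one along every arc bounds the distance from below.
\<close>

lemma potential_le_graph_dist:
  assumes "x \<in> pverts G" "y \<in> pverts G"
    and step: "\<And>u v. (u, v) \<in> parcs G \<Longrightarrow> h u \<le> h v + (1::real)"
  shows "h x - h y \<le> graph_dist G x y"
proof -
  have "h u - h y \<le> real (length p)" if "awalk u p y" for u p
    using that
  proof (induction p arbitrary: u)
    case (Cons e p)
    then have "(u, snd e) \<in> parcs G" "awalk (snd e) p y"
      by (auto simp: awalk_Cons_iff)
    then show ?case
      using Cons.IH[of "snd e"] step[of u "snd e"] by simp
  qed (simp add: awalk_Nil_iff)
  moreover obtain p where "awalk x p y" "graph_dist G x y = real (length p)"
    using graph_dist_attained(1)[OF assms(1,2)] by blast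
  ultimately show ?thesis by metis
qed

end

lemma connected_graph_imp_walk_connected:
  assumes "connected_graph G"
  shows "walk_connected G"
proof -
  have bi: "pair_bidirected_digraph G"
    and con: "strongly_connected (mk_symmetric (with_proj G))"
    using assms by (auto simp: connected_graph_def Digraph_Component.connected_def)
  interpret pair_bidirected_digraph G by (rule bi)
  show ?thesis
  proof unfold_locales
    fix x y assume xy: "x \<in> pverts G" "y \<in> pverts G"
    then have "x \<rightarrow>\<^sup>*\<^bsub>mk_symmetric (with_proj G)\<^esub> y"
      using con by (auto simp: strongly_connected_def)
    then have "x \<rightarrow>\<^sup>*\<^bsub>with_proj G\<^esub> y"
      by (subst (asm) reachable_mk_symmetric_eq[OF sym_arcs])
    then show "\<exists>p. awalk x p y"
      by (simp add: reachable_awalk)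
  qed
qed

lemma awalk_map:
  assumes G: "pair_wf_digraph G" and H: "pair_wf_digraph H"
    and verts: "\<phi> ` pverts G \<subseteq> pverts H"
    and arcs: "map_prod \<phi> \<phi> ` parcs G \<subseteq> parcs H"
    and walk: "pre_digraph.awalk (with_proj G) x p y"
  shows "pre_digraph.awalk (with_proj H) (\<phi> x) (map (map_prod \<phi> \<phi>) p) (\<phi> y)"
proof -
  interpret G: pair_wf_digraph G by (rule G)
  interpret H: pair_wf_digraph H by (rule H)
  show ?thesis
    using walk verts arcs
    by (induction p arbitrary: x)
       (auto simp: G.awalk_Cons_iff G.awalk_Nil_iff H.awalk_Cons_iff H.awalk_Nil_iff)
qed

lemma graph_dist_map_le:
  assumes G: "walk_connected G" and H: "walk_connected H"
    and verts: "\<phi> ` pverts G \<subseteq> pverts H"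
    and arcs: "map_prod \<phi> \<phi> ` parcs G \<subseteq> parcs H"
    and "x \<in> pverts G" "y \<in> pverts G"
  shows "graph_dist H (\<phi> x) (\<phi> y) \<le> graph_dist G x y"
proof -
  interpret G: walk_connected G by (rule G)
  interpret H: walk_connected H by (rule H)
  obtain p where p: "G.awalk x p y" "graph_dist G x y = real (length p)"
    using G.graph_dist_attained(1) assms(5,6) by blast
  have "\<phi> x \<in> pverts H" "\<phi> y \<in> pverts H"
    using verts assms(5,6) by auto
  from H.graph_dist_attained(2)[OF this
      awalk_map[OF G.pair_wf_digraph_axioms H.pair_wf_digraph_axioms verts arcs p(1)]]
  show ?thesis
    using p(2) by simp
qed

section \<open>The QE constant on finite vertex sets\<close>

definition dist_form :: "'a pair_pre_digraph \<Rightarrow> 'a set \<Rightarrow> ('a \<Rightarrow> real) \<Rightarrow> real" where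
  "dist_form G A f = (\<Sum>x\<in>A. \<Sum>y\<in>A. f x * f y * graph_dist G x y)"

lemma pairing_eq_sum:
  assumes "finite A" "{x. f x \<noteq> 0} \<subseteq> A"
  shows "pairing f g = (\<Sum>x\<in>A. f x * g x)" "pairing g f = (\<Sum>x\<in>A. g x * f x)"
  unfolding pairing_def using assms by (auto intro!: Sum_any.expand_superset)

lemma pairing_dist_eq_dist_form:
  assumes "finite A" "{x. f x \<noteq> 0} \<subseteq> A"
  shows "pairing f (dist_matrix_apply G f) = dist_form G A f"
proof -
  have "dist_matrix_apply G f x = (\<Sum>y\<in>A. graph_dist G x y * f y)" for x
    unfolding dist_matrix_apply_def using assms by (auto intro!: Sum_any.expand_superset)
  then show ?thesis
    using pairing_eq_sum(1)[OF assms] by (simp add: dist_form_def sum_distrib_left mult_ac)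
qed

lemma dist_form_le_QEC:
  assumes A: "finite A" "A \<subseteq> pverts G" and zero: "sum f A = 0" and unit: "(\<Sum>x\<in>A. (f x)\<^sup>2) = 1"
  shows "ereal (dist_form G A f) \<le> QEC G"
proof -
  define g where "g x = (if x \<in> A then f x else 0)" for x
  have supp: "{x. g x \<noteq> 0} \<subseteq> A"
    by (auto simp: g_def)
  have g_sums: "sum g A = 0" "(\<Sum>x\<in>A. g x * g x) = 1"
    using zero unit by (simp_all add: g_def power2_eq_square)
  have form: "dist_form G A g = dist_form G A f"
    by (simp add: dist_form_def g_def)
  have "g \<in> C0 (pverts G)"
    using supp A finite_subset unfolding C0_def by blast
  moreover have "pairing g g = 1" "pairing (\<lambda>_. 1) g = 0"
    using pairing_eq_sum[OF A(1) supp] g_sums by simp_all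
  moreover have "pairing g (dist_matrix_apply G g) = dist_form G A f"
    using pairing_dist_eq_dist_form[OF A(1) supp] form by simp
  ultimately show ?thesis
    unfolding QEC_def by (intro SUP_upper2[of g]) auto
qed

text \<open>
  Finite vertex sets may be enlarged by any prescribed vertex, because functions may vanish there.
\<close>

lemma QEC_leI:
  assumes "v \<in> pverts G"
    and bound: "\<And>A f. \<lbrakk>finite A; v \<in> A; A \<subseteq> pverts G; sum f A = 0; (\<Sum>x\<in>A. (f x)\<^sup>2) = 1\<rbrakk>
      \<Longrightarrow> ereal (dist_form G A f) \<le> c"
  shows "QEC G \<le> c"
  unfolding QEC_def
proof (rule SUP_least)
  fix f assume f: "f \<in> {f \<in> C0 (pverts G). pairing f f = 1 \<and> pairing (\<lambda>_. 1) f = 0}"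
  define A where "A = insert v {x. f x \<noteq> 0}"
  have A: "finite A" "{x. f x \<noteq> 0} \<subseteq> A" "v \<in> A" "A \<subseteq> pverts G"
    using f assms(1) by (auto simp: A_def C0_def)
  have "sum f A = 0" "(\<Sum>x\<in>A. (f x)\<^sup>2) = 1"
    using f pairing_eq_sum[OF A(1,2)] by (simp_all add: power2_eq_square)
  then show "ereal (pairing f (dist_matrix_apply G f)) \<le> c"
    using bound[OF A(1,3,4)] pairing_dist_eq_dist_form[OF A(1,2)] by simp
qed

text \<open>The form and the squared norm are both homogeneous of degree two.\<close>

lemma dist_form_le:
  assumes Q: "QEC G = ereal q" and A: "finite A" "A \<subseteq> pverts G" and zero: "sum f A = 0"
  shows "dist_form G A f \<le> q * (\<Sum>x\<in>A. (f x)\<^sup>2)"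
proof (cases "(\<Sum>x\<in>A. (f x)\<^sup>2) = 0")
  case True
  then have "f x = 0" if "x \<in> A" for x
    using that A(1) by (simp add: sum_nonneg_eq_0_iff)
  then show ?thesis
    by (simp add: dist_form_def)
next
  case False
  define c where "c = (\<Sum>x\<in>A. (f x)\<^sup>2)"
  have c: "c > 0"
    using False unfolding c_def by (simp add: less_le sum_nonneg)
  define g where "g x = f x / sqrt c" for x
  have g2: "g x * g y = f x * f y / c" for x y
    using c by (simp add: g_def)
  have "sum g A = 0"
    using zero by (simp add: g_def flip: sum_divide_distrib)
  moreover have "(\<Sum>x\<in>A. (g x)\<^sup>2) = 1"
    using c by (simp add: power2_eq_square g2 c_def flip: sum_divide_distrib)
  ultimately have "dist_form G A g \<le> q"
    using dist_form_le_QEC[OF A, of g] Q by simp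
  moreover have "dist_form G A g = dist_form G A f / c"
    by (simp add: dist_form_def g2 sum_divide_distrib)
  ultimately show ?thesis
    using c by (simp add: c_def field_simps)
qed

lemma QEC_mono_isometry:
  assumes "v \<in> pverts G" and inj: "inj_on \<phi> (pverts G)" and verts: "\<phi> ` pverts G \<subseteq> pverts H"
    and dist: "\<And>x y. \<lbrakk>x \<in> pverts G; y \<in> pverts G\<rbrakk> \<Longrightarrow> graph_dist H (\<phi> x) (\<phi> y) = graph_dist G x y"
  shows "QEC G \<le> QEC H"
proof (rule QEC_leI[OF assms(1)])
  fix A f
  assume A: "finite A" "A \<subseteq> pverts G" and f: "sum f A = 0" "(\<Sum>x\<in>A. (f x)\<^sup>2) = (1::real)"
  define g where "g = f \<circ> inv_into A \<phi>"
  have inj_A: "inj_on \<phi> A"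
    using inj A(2) inj_on_subset by blast
  then have g: "g (\<phi> x) = f x" if "x \<in> A" for x
    using that by (simp add: g_def)
  have "ereal (dist_form H (\<phi> ` A) g) \<le> QEC H"
    using A verts f by (intro dist_form_le_QEC) (auto simp: sum.reindex[OF inj_A] g)
  moreover have "dist_form H (\<phi> ` A) g = dist_form G A f"
    unfolding dist_form_def sum.reindex[OF inj_A] comp_def
    by (intro sum.cong refl) (use A(2) in \<open>auto simp: g dist subset_iff\<close>)
  ultimately show "ereal (dist_form G A f) \<le> QEC H"
    by simp
qed

section \<open>The equation for the upper bound\<close>

lemma star_term_pos:
  assumes "q < 0" "n \<noteq> 0" "l \<le> - q"
  shows "star_term n q l > 0" and "n = enat m \<Longrightarrow> - q * real m - q - l > 0"
proof -
  have den: "- q * real m - q - l > 0" if "n = enat m" for m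
  proof -
    have "m > 0"
      using that assms(2) by (cases m) (auto simp: zero_enat_def)
    then have "- q * real m > 0"
      using assms(1) by (simp add: mult_neg_pos)
    then show ?thesis using assms(3) by linarith
  qed
  then show "n = enat m \<Longrightarrow> - q * real m - q - l > 0" .
  show "star_term n q l > 0"
  proof (cases n)
    case (enat m)
    then have "real m > 0"
      using assms(2) by (cases m) (auto simp: zero_enat_def)
    then show ?thesis
      using den[OF enat] enat by (simp add: star_term_def)
  qed (use assms in \<open>simp add: star_term_def\<close>)
qed

lemma star_term_mono:
  assumes "q < 0" "n \<noteq> 0" "l \<le> l'" "l' \<le> - q"
  shows "star_term n q l \<le> star_term n q l'"
proof (cases n)
  case (enat m)
  then show ?thesis
    using star_term_pos(2)[OF assms(1,2,4) enat] assms(3)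
    by (auto simp: star_term_def intro!: divide_left_mono mult_pos_pos)
qed (simp add: star_term_def)

lemma star_term_end:
  assumes "q < 0" "n \<noteq> 0"
  shows "star_term n q (- q) = 1 / (- q)"
proof (cases n)
  case (enat m)
  then have "real m > 0"
    using assms(2) by (cases m) (auto simp: zero_enat_def)
  then show ?thesis
    using enat assms(1) by (simp add: star_term_def field_simps)
qed (simp add: star_term_def)

text \<open>
  On \<open>(0, min\<^sub>j (- Q\<^sub>j)]\<close> no denominator vanishes, and \<open>\<lambda>\<close> times the left-hand
  side grows from \<open>0\<close> to at least \<open>1\<close>: at the right end the term that belongs to the
  minimum alone contributes \<open>1\<close>.  The intermediate value theorem gives a solution there.
  It is the smallest one, because to its left the two sides have opposite signs or are
  strictly separated by monotonicity.
\<close>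

lemma minimal_star_solution_exists:
  assumes "r \<ge> 1" and Q: "\<And>j. j \<in> {1..r} \<Longrightarrow> Q j < 0" and n: "\<And>j. j \<in> {1..r} \<Longrightarrow> n j \<noteq> 0"
  obtains \<Lambda> where "minimal_star_solution r n Q \<Lambda>" "\<Lambda> > 0" "\<And>j. j \<in> {1..r} \<Longrightarrow> \<Lambda> \<le> - Q j"
proof -
  define c where "c = Min ((\<lambda>j. - Q j) ` {1..r})"
  define T where "T l = (\<Sum>j=1..r. star_term (n j) (Q j) l)" for l
  have c_le: "c \<le> - Q j" if "j \<in> {1..r}" for j
    unfolding c_def using that by (intro Min_le) auto
  have "c \<in> (\<lambda>j. - Q j) ` {1..r}"
    unfolding c_def using assms(1) by (intro Min_in) auto
  then obtain i where i: "i \<in> {1..r}" "c = - Q i"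
    by auto
  then have c_pos: "c > 0"
    using Q by simp
  have T_pos: "T l > 0" if "l \<le> c" for l
    unfolding T_def using assms(1) that c_le Q n
    by (intro sum_pos star_term_pos(1)) (auto intro: order_trans)
  have T_mono: "T l \<le> T l'" if "l \<le> l'" "l' \<le> c" for l l'
    unfolding T_def using that c_le Q n by (intro sum_mono star_term_mono) (auto intro: order_trans)
  have "1 / c \<le> T c"
    using member_le_sum[of i "{1..r}" "\<lambda>j. star_term (n j) (Q j) c"]
      star_term_end[OF Q[OF i(1)] n[OF i(1)]] star_term_pos(1)[OF Q n c_le] i
    by (force simp: T_def less_imp_le)
  then have "1 \<le> c * T c"
    using c_pos by (simp add: field_simps)
  moreover have "continuous_on {0..c} (\<lambda>l. l * T l)"
  proof -
    have "continuous_on {0..c} (star_term (n j) (Q j))" if j: "j \<in> {1..r}" for j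
    proof (cases "n j")
      case (enat m)
      have "- Q j * real m - Q j - l \<noteq> 0" if "l \<in> {0..c}" for l
        using star_term_pos(2)[OF Q[OF j] n[OF j] _ enat, of l] c_le[OF j] that by fastforce
      then show ?thesis
        unfolding star_term_def enat enat.case by (intro continuous_intros) auto
    qed (simp add: star_term_def)
    then show ?thesis
      unfolding T_def by (intro continuous_intros) auto
  qed
  ultimately obtain \<Lambda> where \<Lambda>: "0 \<le> \<Lambda>" "\<Lambda> \<le> c" "\<Lambda> * T \<Lambda> = 1"
    using IVT'[of "\<lambda>l. l * T l" 0 1 c] c_pos by auto
  then have \<Lambda>_pos: "\<Lambda> > 0"
    by (cases "\<Lambda> = 0") auto
  have T_\<Lambda>: "T \<Lambda> = 1 / \<Lambda>"
    using \<Lambda>(3) \<Lambda>_pos by (simp add: field_simps)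
  have \<Lambda>_le: "\<Lambda> \<le> - Q j" if "j \<in> {1..r}" for j
    using c_le[OF that] \<Lambda>(2) by linarith
  have "star_solution r n Q \<Lambda>"
    unfolding star_solution_def
    using \<Lambda>_pos T_\<Lambda> star_term_pos(2)[OF Q n \<Lambda>_le] by (fastforce simp: T_def)
  moreover have "\<Lambda> \<le> l" if "star_solution r n Q l" for l
  proof (rule ccontr)
    assume "\<not> \<Lambda> \<le> l"
    then have l: "l < \<Lambda>" "l \<le> c"
      using \<Lambda>(2) by auto
    have Tl: "l \<noteq> 0" "T l = 1 / l"
      using that by (auto simp: star_solution_def T_def)
    then have "l > 0"
      using T_pos[OF l(2)] by (simp add: zero_less_divide_iff)
    then have "1 / \<Lambda> < T l"
      using l(1) Tl(2) by (simp add: frac_less2)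
    then show False
      using T_mono[of l \<Lambda>] l(1) \<Lambda>(2) T_\<Lambda> by simp
  qed
  ultimately show ?thesis
    using that \<Lambda>_pos \<Lambda>_le by (auto simp: minimal_star_solution_def)
qed

section \<open>Distances in the star product\<close>

locale connected_star =
  fixes r :: nat and G :: "nat \<Rightarrow> 'a pair_pre_digraph" and b :: "nat \<Rightarrow> 'a"
  assumes factor: "j \<in> {1..r} \<Longrightarrow> walk_connected (G j)"
    and base: "j \<in> {1..r} \<Longrightarrow> b j \<in> pverts (G j)"
begin

abbreviation "star \<equiv> star_product r G b"
abbreviation "\<sigma> \<equiv> star_map b"

lemma star_map_base [simp]: "\<sigma> j (b j) = None"
  by (simp add: star_map_def)

lemma factor_verts: "j \<in> {1..r} \<Longrightarrow> \<sigma> j ` pverts (G j) \<subseteq> pverts star"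
  by (auto simp: star_product_def)

lemma factor_arcs: "j \<in> {1..r} \<Longrightarrow> map_prod (\<sigma> j) (\<sigma> j) ` parcs (G j) \<subseteq> parcs star"
  by (auto simp: star_product_def)

lemma star_wf: "pair_wf_digraph star"
proof
  fix e assume "e \<in> parcs star"
  then obtain j a where j: "j \<in> {1..r}" "a \<in> parcs (G j)" "e = map_prod (\<sigma> j) (\<sigma> j) a"
    by (auto simp: star_product_def)
  interpret G: walk_connected "G j" using factor j(1) .
  show "fst e \<in> pverts star" "snd e \<in> pverts star"
    using G.arc_fst_in_verts[OF j(2)] G.arc_snd_in_verts[OF j(2)] factor_verts[OF j(1)] j(3)
    by auto
qed

lemma star_vertE:
  assumes "z \<in> pverts star"
  obtains j x where "j \<in> {1..r}" "x \<in> pverts (G j)" "z = \<sigma> j x"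
  using assms by (auto simp: star_product_def)

lemma star_walk_connected: "walk_connected star"
proof -
  interpret S: pair_wf_digraph star by (rule star_wf)
  have factor_walk: "\<exists>p. S.awalk (\<sigma> j x) p (\<sigma> j y)"
    if j: "j \<in> {1..r}" and xy: "x \<in> pverts (G j)" "y \<in> pverts (G j)" for j x y
  proof -
    interpret G: walk_connected "G j" using factor j .
    show ?thesis
      using G.ex_awalk[OF xy] awalk_map[OF G.pair_wf_digraph_axioms star_wf
          factor_verts[OF j] factor_arcs[OF j]] by blast
  qed
  show ?thesis
  proof unfold_locales
    fix z w assume "z \<in> pverts star" "w \<in> pverts star"
    then obtain j x k y where zw: "j \<in> {1..r}" "x \<in> pverts (G j)" "z = \<sigma> j x"
        "k \<in> {1..r}" "y \<in> pverts (G k)" "w = \<sigma> k y"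
      by (elim star_vertE) blast
    obtain p where "S.awalk z p None"
      using factor_walk[OF zw(1,2) base[OF zw(1)]] zw(3) by auto
    moreover obtain q where "S.awalk None q w"
      using factor_walk[OF zw(4) base[OF zw(4)] zw(5)] zw(6) by auto
    ultimately show "\<exists>p. S.awalk z p w"
      using S.awalk_appendI by blast
  qed
qed

text \<open>
  The length of a shortest way from \<open>x\<close> in factor \<open>j\<close> to \<open>y\<close> in factor
  \<open>k\<close>, which changes factors only at the common vertex.
\<close>

definition route :: "nat \<Rightarrow> 'a \<Rightarrow> nat \<Rightarrow> 'a \<Rightarrow> real" where
  "route j x k y = (if j = k then graph_dist (G k) x y
                    else graph_dist (G j) x (b j) + graph_dist (G k) (b k) y)"

text \<open>
  The same quantity as a function of the vertex of the star, for a fixed target \<open>y\<close> in factor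
  \<open>k\<close>.  It is well defined at the common vertex, because every base point has distance zero
  from itself.
\<close>

definition potential :: "nat \<Rightarrow> 'a \<Rightarrow> (nat \<times> 'a) option \<Rightarrow> real" where
  "potential k y z = (case z of None \<Rightarrow> graph_dist (G k) (b k) y | Some (j, x) \<Rightarrow> route j x k y)"

lemma potential_star_map:
  assumes "j \<in> {1..r}"
  shows "potential k y (\<sigma> j x) = route j x k y"
proof -
  interpret G: walk_connected "G j" using factor assms .
  show ?thesis
    using G.graph_dist_refl[OF base[OF assms]]
    by (auto simp: potential_def star_map_def route_def)
qed

lemma route_step:
  assumes j: "j \<in> {1..r}" and k: "k \<in> {1..r}" and y: "y \<in> pverts (G k)"
    and uv: "(u, v) \<in> parcs (G j)"
  shows "route j u k y \<le> route j v k y + 1"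
proof -
  interpret G: walk_connected "G j" using factor j .
  have "u \<in> pverts (G j)" "v \<in> pverts (G j)"
    using G.arc_fst_in_verts[OF uv] G.arc_snd_in_verts[OF uv] by auto
  then have "graph_dist (G j) u w \<le> graph_dist (G j) v w + 1" if "w \<in> pverts (G j)" for w
    using G.graph_dist_triangle[of u v w] G.graph_dist_arc[OF uv] that by simp
  then show ?thesis
    using base[OF j] y by (cases "j = k") (simp_all add: route_def)
qed

text \<open>
  Walks in the factors, joined at the common vertex, give the upper bound.  For the lower bound
  walks in the star need not be cut into pieces: every arc of the star comes from one factor, so
  the potential drops by at most one along it.
\<close>

theorem graph_dist_star:
  assumes j: "j \<in> {1..r}" and x: "x \<in> pverts (G j)" and k: "k \<in> {1..r}" and y: "y \<in> pverts (G k)"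
  shows "graph_dist star (\<sigma> j x) (\<sigma> k y) = route j x k y"
proof (rule antisym)
  interpret S: walk_connected star by (rule star_walk_connected)
  interpret Gk: walk_connected "G k" using factor k .
  have within: "graph_dist star (\<sigma> i u) (\<sigma> i v) \<le> graph_dist (G i) u v"
    if "i \<in> {1..r}" "u \<in> pverts (G i)" "v \<in> pverts (G i)" for i u v
    using graph_dist_map_le[OF factor star_walk_connected factor_verts factor_arcs] that by blast
  have "\<sigma> j (b j) \<in> pverts star" and verts: "\<sigma> j x \<in> pverts star" "\<sigma> k y \<in> pverts star"
    using factor_verts[OF j] factor_verts[OF k] base[OF j] x y by blast+
  then have None_vert: "None \<in> pverts star"
    by simp
  show "graph_dist star (\<sigma> j x) (\<sigma> k y) \<le> route j x k y"
  proof (cases "j = k")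
    case True
    then show ?thesis using within x y k by (simp add: route_def)
  next
    case False
    then show ?thesis
      using S.graph_dist_triangle[OF verts(1) None_vert verts(2)] within[OF j x base[OF j]]
        within[OF k base[OF k] y] by (simp add: route_def)
  qed
  have "potential k y z \<le> potential k y w + 1" if zw: "(z, w) \<in> parcs star" for z w
  proof -
    obtain i u v where "i \<in> {1..r}" "(u, v) \<in> parcs (G i)" "z = \<sigma> i u" "w = \<sigma> i v"
      using zw by (auto simp: star_product_def)
    then show ?thesis
      using route_step[OF _ k y] by (simp add: potential_star_map)
  qed
  from S.potential_le_graph_dist[where h = "potential k y", OF verts(1,2) this]
  show "route j x k y \<le> graph_dist star (\<sigma> j x) (\<sigma> k y)"
    using j k y Gk.graph_dist_refl by (simp add: potential_star_map route_def)
qed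

section \<open>Splitting a function on the star product\<close>

lemma star_support_split:
  assumes "None \<in> A" "A \<subseteq> pverts star"
  shows "A = insert None (Some ` (SIGMA j:{1..r}. {x. Some (j, x) \<in> A}))"
proof (rule set_eqI)
  fix z
  show "z \<in> A \<longleftrightarrow> z \<in> insert None (Some ` (SIGMA j:{1..r}. {x. Some (j, x) \<in> A}))"
  proof (cases z)
    case None
    then show ?thesis using assms(1) by simp
  next
    case (Some p)
    obtain j x where "p = (j, x)" by fastforce
    then have z: "z = Some (j, x)" using Some by simp
    have "j \<in> {1..r}" if "z \<in> A"
    proof -
      from that assms(2) obtain i u where "i \<in> {1..r}" "z = \<sigma> i u"
        by (meson star_vertE subsetD)
      then show ?thesis
        using z by (auto simp: star_map_def split: if_splits)
    qed
    then show ?thesis using z by auto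
  qed
qed

text \<open>
  A function of sum zero on the star is the sum of functions of sum zero on the factors: each
  piece keeps the values away from the base point and takes there the value that makes its sum
  vanish.  These values add up to the value at the common vertex.  Written in terms of all
  linear functionals \<open>\<phi>\<close>, the decomposition can be applied in each argument of a bilinear
  form.
\<close>

lemma zero_sum_pieces:
  fixes f :: "(nat \<times> 'a) option \<Rightarrow> real"
  assumes A: "finite A" "None \<in> A" "A \<subseteq> pverts star" and zero: "sum f A = 0"
  obtains B g where
    "\<And>j. j \<in> {1..r} \<Longrightarrow> finite (B j)"
    "\<And>j. j \<in> {1..r} \<Longrightarrow> B j \<subseteq> pverts (G j)"
    "\<And>j. j \<in> {1..r} \<Longrightarrow> b j \<in> B j"
    "\<And>j. j \<in> {1..r} \<Longrightarrow> sum (g j) (B j) = 0"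
    "\<And>\<phi>. (\<Sum>z\<in>A. f z * \<phi> z) = (\<Sum>j=1..r. \<Sum>x\<in>B j. g j x * \<phi> (\<sigma> j x))"
    "(\<Sum>z\<in>A. (f z)\<^sup>2) = (\<Sum>j=1..r. g j (b j))\<^sup>2 + (\<Sum>j=1..r. \<Sum>x\<in>B j - {b j}. (g j x)\<^sup>2)"
proof -
  define U where "U j = {x. Some (j, x) \<in> A}" for j
  define B where "B j = insert (b j) (U j)" for j
  define g where "g j x = (if x = b j then - (\<Sum>u\<in>U j. f (Some (j, u))) else f (Some (j, x)))"
    for j x
  have U_sub: "U j \<subseteq> pverts (G j) - {b j}" if "j \<in> {1..r}" for j
  proof
    fix x assume "x \<in> U j"
    then have "Some (j, x) \<in> pverts star" using A(3) by (auto simp: U_def)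
    then obtain i u where "i \<in> {1..r}" "u \<in> pverts (G i)" "Some (j, x) = \<sigma> i u"
      by (rule star_vertE)
    then show "x \<in> pverts (G j) - {b j}"
      by (auto simp: star_map_def split: if_splits)
  qed
  have U_fin: "finite (U j)" for j
    unfolding U_def using finite_vimageI[OF A(1), of "\<lambda>x. Some (j, x)"]
    by (simp add: vimage_def inj_on_def)
  have sum_A: "(\<Sum>z\<in>A. h z) = h None + (\<Sum>j=1..r. \<Sum>x\<in>U j. h (Some (j, x)))"
    for h :: "_ \<Rightarrow> real"
  proof -
    have A_eq: "A = insert None (Some ` (SIGMA j:{1..r}. U j))"
      using star_support_split[OF A(2,3)] by (simp add: U_def)
    have "(\<Sum>z\<in>A. h z) = h None + (\<Sum>p\<in>(SIGMA j:{1..r}. U j). h (Some p))"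
      unfolding A_eq using U_fin by (subst sum.insert) (auto simp: sum.reindex)
    then show ?thesis
      using U_fin by (simp add: sum.Sigma split_def)
  qed
  have B_minus: "B j - {b j} = U j" if "j \<in> {1..r}" for j
    using U_sub[OF that] by (auto simp: B_def)
  have g_U: "g j x = f (Some (j, x))" "\<sigma> j x = Some (j, x)" if "j \<in> {1..r}" "x \<in> U j" for j x
    using U_sub[OF that(1)] that(2) by (auto simp: g_def star_map_def)
  have sum_B: "(\<Sum>x\<in>B j. h x) = h (b j) + (\<Sum>x\<in>U j. h x)" if "j \<in> {1..r}"
    for j and h :: "_ \<Rightarrow> real"
    using U_sub[OF that] U_fin by (subst B_def, subst sum.insert) auto
  have f_None: "f None = (\<Sum>j=1..r. g j (b j))"
    using zero sum_A[of f] by (simp add: g_def sum_negf)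
  show thesis
  proof (rule that[of B g])
    fix j assume j: "j \<in> {1..r}"
    show "finite (B j)" "b j \<in> B j"
      using U_fin by (auto simp: B_def)
    show "B j \<subseteq> pverts (G j)"
      using U_sub[OF j] base[OF j] by (auto simp: B_def)
    have "sum (g j) (U j) = (\<Sum>u\<in>U j. f (Some (j, u)))"
      using g_U j by (intro sum.cong) auto
    then show "sum (g j) (B j) = 0"
      using sum_B[OF j] by (simp add: g_def)
  next
    fix \<phi> :: "_ \<Rightarrow> real"
    have "(\<Sum>x\<in>B j. g j x * \<phi> (\<sigma> j x)) =
        g j (b j) * \<phi> None + (\<Sum>x\<in>U j. f (Some (j, x)) * \<phi> (Some (j, x)))"
      if j: "j \<in> {1..r}" for j
      unfolding sum_B[OF j] star_map_base using g_U[OF j] by (auto intro!: sum.cong)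
    then have "(\<Sum>j=1..r. \<Sum>x\<in>B j. g j x * \<phi> (\<sigma> j x)) =
        f None * \<phi> None + (\<Sum>j=1..r. \<Sum>x\<in>U j. f (Some (j, x)) * \<phi> (Some (j, x)))"
      by (simp add: sum.distrib f_None sum_distrib_right)
    then show "(\<Sum>z\<in>A. f z * \<phi> z) = (\<Sum>j=1..r. \<Sum>x\<in>B j. g j x * \<phi> (\<sigma> j x))"
      using sum_A[of "\<lambda>z. f z * \<phi> z"] by simp
  next
    have "(\<Sum>j=1..r. \<Sum>x\<in>B j - {b j}. (g j x)\<^sup>2) = (\<Sum>j=1..r. \<Sum>x\<in>U j. (f (Some (j, x)))\<^sup>2)"
      using B_minus g_U by (intro sum.cong) auto
    then show "(\<Sum>z\<in>A. (f z)\<^sup>2) =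
        (\<Sum>j=1..r. g j (b j))\<^sup>2 + (\<Sum>j=1..r. \<Sum>x\<in>B j - {b j}. (g j x)\<^sup>2)"
      using sum_A[of "\<lambda>z. (f z)\<^sup>2"] f_None by simp
  qed
qed

text \<open>
  Between two different factors the distance is a function of \<open>x\<close> plus a function of
  \<open>y\<close>, and the form of such a kernel vanishes on functions of sum zero.  So no mixed terms
  survive.
\<close>

lemma dist_form_pieces:
  assumes B: "\<And>j. j \<in> {1..r} \<Longrightarrow> B j \<subseteq> pverts (G j)"
    and zero: "\<And>j. j \<in> {1..r} \<Longrightarrow> sum (g j) (B j) = 0"
    and split: "\<And>\<phi>. (\<Sum>z\<in>A. f z * \<phi> z) = (\<Sum>j=1..r. \<Sum>x\<in>B j. g j x * \<phi> (\<sigma> j x))"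
  shows "dist_form star A f = (\<Sum>j=1..r. dist_form (G j) (B j) (g j))"
proof -
  have "dist_form star A f = (\<Sum>z\<in>A. f z * (\<Sum>w\<in>A. f w * graph_dist star z w))"
    by (simp add: dist_form_def sum_distrib_left mult.assoc)
  also have "\<dots> = (\<Sum>j=1..r. \<Sum>x\<in>B j. g j x *
      (\<Sum>k=1..r. \<Sum>y\<in>B k. g k y * graph_dist star (\<sigma> j x) (\<sigma> k y)))"
    by (simp only: split)
  also have "\<dots> = (\<Sum>j=1..r. \<Sum>x\<in>B j. \<Sum>k=1..r. g j x * (\<Sum>y\<in>B k. g k y * route j x k y))"
    unfolding sum_distrib_left[of _ _ "{1..r}"]
    using B by (intro sum.cong refl arg_cong2[where f = times] graph_dist_star) blast+
  also have "\<dots> = (\<Sum>j=1..r. \<Sum>k=1..r. \<Sum>x\<in>B j. g j x * (\<Sum>y\<in>B k. g k y * route j x k y))"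
    by (intro sum.cong refl sum.swap)
  also have "\<dots> = (\<Sum>j=1..r. \<Sum>k=1..r. if k = j then dist_form (G j) (B j) (g j) else 0)"
  proof (intro sum.cong refl)
    fix j k assume j: "j \<in> {1..r}" and k: "k \<in> {1..r}"
    show "(\<Sum>x\<in>B j. g j x * (\<Sum>y\<in>B k. g k y * route j x k y)) =
        (if k = j then dist_form (G j) (B j) (g j) else 0)"
    proof (cases "k = j")
      case True
      then show ?thesis
        by (simp add: route_def dist_form_def sum_distrib_left mult.assoc)
    next
      case False
      have "(\<Sum>y\<in>B k. g k y * route j x k y) = (\<Sum>y\<in>B k. g k y * graph_dist (G k) (b k) y)" for x
        using False zero[OF k]
        by (simp add: route_def distrib_left sum.distrib flip: sum_distrib_right)
      then show ?thesis
        using False zero[OF j] by (simp flip: sum_distrib_right)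
    qed
  qed
  also have "\<dots> = (\<Sum>j=1..r. dist_form (G j) (B j) (g j))"
    by (simp add: sum.delta)
  finally show ?thesis .
qed

end

section \<open>The two bounds\<close>

text \<open>The Cauchy-Schwarz inequality for \<open>s\<^sub>j / \<surd>t\<^sub>j\<close> and \<open>\<surd>t\<^sub>j\<close>.\<close>

lemma sum_squared_le_weighted:
  fixes s t :: "'b \<Rightarrow> real"
  assumes "\<And>j. j \<in> J \<Longrightarrow> t j > 0"
  shows "(\<Sum>j\<in>J. s j)\<^sup>2 \<le> (\<Sum>j\<in>J. (s j)\<^sup>2 / t j) * (\<Sum>j\<in>J. t j)"
proof -
  have "(\<Sum>j\<in>J. s j)\<^sup>2 = (\<Sum>j\<in>J. (s j / sqrt (t j)) * sqrt (t j))\<^sup>2"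
    by (intro arg_cong[where f = "\<lambda>x. x\<^sup>2"] sum.cong) (auto dest: assms)
  also have "\<dots> \<le> (\<Sum>j\<in>J. (s j / sqrt (t j))\<^sup>2) * (\<Sum>j\<in>J. (sqrt (t j))\<^sup>2)"
    by (rule Cauchy_Schwarz_ineq_sum)
  also have "\<dots> = (\<Sum>j\<in>J. (s j)\<^sup>2 / t j) * (\<Sum>j\<in>J. t j)"
    using assms by (intro arg_cong2[where f = times] sum.cong)
       (auto simp: power_divide less_imp_le)
  finally show ?thesis .
qed

text \<open>
  Here \<open>s\<close> stands for the value of a piece at the base point and \<open>P\<close> for its squared
  norm elsewhere.  For finite \<open>n\<close> the right-hand side with \<open>P\<close> replaced by
  \<open>s\<^sup>2 / n\<close> equals the left-hand side: this is where the terms of the equation for the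
  upper bound come from.  For infinite \<open>n\<close> the norm elsewhere has no lower bound in terms
  of \<open>s\<close>, and its contribution is dropped.
\<close>

lemma piece_bound:
  assumes q: "q < 0" and n: "n \<noteq> 0" and l: "l \<le> - q" and P: "P \<ge> 0"
    and s: "\<And>m. n = enat m \<Longrightarrow> s\<^sup>2 \<le> real m * P"
  shows "s\<^sup>2 / star_term n q l \<le> (- q - l) * P - q * s\<^sup>2"
proof (cases n)
  case (enat m)
  then have m: "real m > 0"
    using n by (cases m) (auto simp: zero_enat_def)
  have "s\<^sup>2 / star_term n q l = (- q - l) * (s\<^sup>2 / real m) - q * s\<^sup>2"
    using m enat by (simp add: star_term_def field_simps)
  also have "(- q - l) * (s\<^sup>2 / real m) \<le> (- q - l) * P"
    using s[OF enat] m l by (intro mult_left_mono) (auto simp: field_simps)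
  finally show ?thesis by simp
next
  case infinity
  then show ?thesis
    using P l by (simp add: star_term_def mult_ac)
qed

theorem theorem4p5:
  fixes r :: nat
    and G :: "nat \<Rightarrow> 'a pair_pre_digraph"
    and b :: "nat \<Rightarrow> 'a"
    and n :: "nat \<Rightarrow> enat"
    and Q :: "nat \<Rightarrow> real"
  assumes "r \<ge> 1"
    and "\<And>j. j \<in> {1..r} \<Longrightarrow> connected_graph (G j)"
    and "\<And>j. j \<in> {1..r} \<Longrightarrow> n j + 1 = vertex_count (G j)"
    and "\<And>j. j \<in> {1..r} \<Longrightarrow> vertex_count (G j) \<ge> 2"
    and "\<And>j. j \<in> {1..r} \<Longrightarrow> b j \<in> pverts (G j)"
    and "\<And>j. j \<in> {1..r} \<Longrightarrow> qe_class TYPE('h::{real_inner, complete_space}) (G j)"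
    and "\<And>j. j \<in> {1..r} \<Longrightarrow> QEC (G j) = ereal (Q j)"
    and "\<And>j. j \<in> {1..r} \<Longrightarrow> Q j < 0"
  shows "\<exists>\<Lambda>. minimal_star_solution r n Q \<Lambda> \<and>
           ereal (Max (Q ` {1..r})) \<le> QEC (star_product r G b) \<and>
           QEC (star_product r G b) \<le> ereal (- \<Lambda>)"
proof -
  interpret connected_star r G b
    using assms(2,5) by (intro connected_star.intro connected_graph_imp_walk_connected)
  have n0: "n j \<noteq> 0" if "j \<in> {1..r}" for j
  proof
    assume "n j = 0"
    then have "(2::enat) \<le> 1"
      using assms(3,4)[OF that] by simp
    then show False
      by (simp add: one_enat_def numeral_eq_enat)
  qed
  have card_rest: "finite (pverts (G j)) \<and> card (pverts (G j) - {b j}) = m"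
    if "j \<in> {1..r}" "n j = enat m" for j m
    using assms(3)[OF that(1)] assms(5)[OF that(1)] that(2)
    by (auto simp: vertex_count_def one_enat_def split: if_splits)
  obtain \<Lambda> where min_sol: "minimal_star_solution r n Q \<Lambda>" and \<Lambda>_pos: "\<Lambda> > 0"
    and \<Lambda>_le: "\<And>j. j \<in> {1..r} \<Longrightarrow> \<Lambda> \<le> - Q j"
    using minimal_star_solution_exists[of r Q n] assms(1,8) n0 by blast
  define t where "t j = star_term (n j) (Q j) \<Lambda>" for j
  have t_pos: "t j > 0" if "j \<in> {1..r}" for j
    unfolding t_def using star_term_pos(1)[OF assms(8) n0 \<Lambda>_le] that by blast
  have t_sum: "(\<Sum>j=1..r. t j) = 1 / \<Lambda>"
    using min_sol by (simp add: minimal_star_solution_def star_solution_def t_def)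
  have None_vert: "None \<in> pverts star"
    using factor_verts[of 1] base[of 1] assms(1) star_map_base[of 1] by force

  have "Max (Q ` {1..r}) \<in> Q ` {1..r}"
    using assms(1) by (intro Max_in) auto
  then obtain i where i: "i \<in> {1..r}" "Max (Q ` {1..r}) = Q i"
    by auto
  have "QEC (G i) \<le> QEC star"
  proof (rule QEC_mono_isometry[OF base[OF i(1)] _ factor_verts[OF i(1)]])
    show "inj_on (\<sigma> i) (pverts (G i))"
      by (auto simp: inj_on_def star_map_def split: if_splits)
    show "graph_dist star (\<sigma> i x) (\<sigma> i y) = graph_dist (G i) x y"
      if "x \<in> pverts (G i)" "y \<in> pverts (G i)" for x y
      using graph_dist_star[OF i(1) that(1) i(1) that(2)] by (simp add: route_def)
  qed
  then have lower: "ereal (Max (Q ` {1..r})) \<le> QEC star"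
    using assms(7) i by simp

  have upper: "QEC star \<le> ereal (- \<Lambda>)"
  proof (rule QEC_leI[OF None_vert])
    fix A and f :: "(nat \<times> 'a) option \<Rightarrow> real"
    assume A: "finite A" "None \<in> A" "A \<subseteq> pverts star" "sum f A = 0"
      and unit: "(\<Sum>z\<in>A. (f z)\<^sup>2) = 1"
    obtain B g where fin: "\<And>j. j \<in> {1..r} \<Longrightarrow> finite (B j)"
      and sub: "\<And>j. j \<in> {1..r} \<Longrightarrow> B j \<subseteq> pverts (G j)"
      and bB: "\<And>j. j \<in> {1..r} \<Longrightarrow> b j \<in> B j"
      and zero: "\<And>j. j \<in> {1..r} \<Longrightarrow> sum (g j) (B j) = 0"
      and split: "\<And>\<phi>. (\<Sum>z\<in>A. f z * \<phi> z) = (\<Sum>j=1..r. \<Sum>x\<in>B j. g j x * \<phi> (\<sigma> j x))"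
      and norm: "(\<Sum>z\<in>A. (f z)\<^sup>2) =
        (\<Sum>j=1..r. g j (b j))\<^sup>2 + (\<Sum>j=1..r. \<Sum>x\<in>B j - {b j}. (g j x)\<^sup>2)"
      by (rule zero_sum_pieces[OF A]) blast
    define s where "s j = g j (b j)" for j
    define P where "P j = (\<Sum>x\<in>B j - {b j}. (g j x)\<^sup>2)" for j
    have piece: "(s j)\<^sup>2 / t j \<le> (- Q j - \<Lambda>) * P j - Q j * (s j)\<^sup>2" if j: "j \<in> {1..r}" for j
      unfolding t_def
    proof (rule piece_bound[OF assms(8)[OF j] n0[OF j] \<Lambda>_le[OF j]])
      show "P j \<ge> 0"
        by (simp add: P_def sum_nonneg)
      fix m assume "n j = enat m"
      then have V: "finite (pverts (G j))" "card (pverts (G j) - {b j}) = m"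
        using card_rest[OF j] by auto
      have "s j = - (\<Sum>x\<in>B j - {b j}. g j x)"
        using sum.remove[OF fin[OF j] bB[OF j], of "g j"] zero[OF j] by (simp add: s_def)
      then have "(s j)\<^sup>2 \<le> P j * real (card (B j - {b j}))"
        using sum_squared_le_sum_of_squares[of "g j" "B j - {b j}"] by (simp add: P_def)
      also have "\<dots> \<le> P j * real m"
      proof (rule mult_left_mono)
        have "card (B j - {b j}) \<le> card (pverts (G j) - {b j})"
          using V(1) sub[OF j] by (intro card_mono) auto
        then show "real (card (B j - {b j})) \<le> real m"
          using V(2) by simp
      qed (simp add: P_def sum_nonneg)
      finally show "(s j)\<^sup>2 \<le> real m * P j"
        by (simp add: mult.commute)
    qed
    have "dist_form star A f = (\<Sum>j=1..r. dist_form (G j) (B j) (g j))"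
      by (rule dist_form_pieces[OF sub zero split])
    also have "\<dots> \<le> (\<Sum>j=1..r. Q j * (\<Sum>x\<in>B j. (g j x)\<^sup>2))"
      using assms(7) fin sub zero by (intro sum_mono dist_form_le) auto
    also have "\<dots> = (\<Sum>j=1..r. Q j * ((s j)\<^sup>2 + P j))"
    proof (rule sum.cong[OF refl])
      fix j assume j: "j \<in> {1..r}"
      show "Q j * (\<Sum>x\<in>B j. (g j x)\<^sup>2) = Q j * ((s j)\<^sup>2 + P j)"
        using sum.remove[OF fin[OF j] bB[OF j], of "\<lambda>x. (g j x)\<^sup>2"] by (simp add: s_def P_def)
    qed
    also have "\<dots> \<le> (\<Sum>j=1..r. - \<Lambda> * P j - (s j)\<^sup>2 / t j)"
    proof (rule sum_mono)
      fix j assume "j \<in> {1..r}"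
      from piece[OF this] show "Q j * ((s j)\<^sup>2 + P j) \<le> - \<Lambda> * P j - (s j)\<^sup>2 / t j"
        by (simp add: algebra_simps)
    qed
    also have "\<dots> = - \<Lambda> * (\<Sum>j=1..r. P j) - (\<Sum>j=1..r. (s j)\<^sup>2 / t j)"
      by (simp add: sum_subtractf sum_negf sum_distrib_left)
    also have "\<dots> \<le> - \<Lambda> * (\<Sum>j=1..r. P j) - \<Lambda> * (\<Sum>j=1..r. s j)\<^sup>2"
    proof -
      have "(\<Sum>j=1..r. s j)\<^sup>2 \<le> (\<Sum>j=1..r. (s j)\<^sup>2 / t j) / \<Lambda>"
        using sum_squared_le_weighted[of "{1..r}" t s, OF t_pos] unfolding t_sum by simp
      then show ?thesis
        using \<Lambda>_pos by (simp add: pos_le_divide_eq mult.commute)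
    qed
    also have "\<dots> = - \<Lambda> * ((\<Sum>j=1..r. s j)\<^sup>2 + (\<Sum>j=1..r. P j))"
      by (simp add: algebra_simps)
    also have "\<dots> = - \<Lambda>"
      using norm unit by (simp add: s_def P_def)
    finally show "ereal (dist_form star A f) \<le> ereal (- \<Lambda>)"
      by simp
  qed
  show ?thesis
    using min_sol lower upper by blast
qed

end
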